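(* Let $(\mathcal{A},\mathcal{Q})$ be a projective reconstruction of $\mathcal{P}$, with $\mathcal{A}=\{A_1,\ldots,A_m\}$ and $\mathcal{Q}=\{\mathbf{q}_1,\ldots,\mathbf{q}_n\}$, and let $\sigma_{ik}=\operatorname{sign}(\mathbf{n}_i^\top\mathbf{q}_k)\in\{-1,1\}$. Then there is an $H\in\mathrm{GL}_4(\mathbb{R})$ with last row $\mathbf{h}^\top$ such that $(\mathcal{A}H^{-1},H\mathcal{Q})$ is a chiral reconstruction of $\mathcal{P}$ if and only if at least one of the following sets is nonempty: $$\mathcal{S}_1=\left\{\mathbf{h}\in\mathbb{R}^4:\ (\mathbf{h}^\top\mathbf{q}_k)(\mathbf{h}^\top\mathbf{c}_i)\sigma_{ik}\ge0\ \text{ and }\ (\mathbf{h}^\top\mathbf{c}_i)(\mathbf{h}^\top\mathbf{c}_j)\sigma_{ik}\sigma_{jk}>0\quad\forall\, i,j,k\right\},$$ $$\mathcal{S}_2=\left\{\mathbf{h}\in\mathbb{R}^4:\ (\mathbf{h}^\top\mathbf{q}_k)(\mathbf{h}^\top\mathbf{c}_i)\sigma_{ik}\le0\ \text{ and }\ (\mathbf{h}^\top\mathbf{c}_i)(\mathbf{h}^\top\mathbf{c}_j)\sigma_{ik}\sigma_{jk}>0\quad\forall\, i,j,k\right\},$$ where $i,j$ range over $\{1,\ldots,m\}$ and $k$ over $\{1,\ldots,n\}$.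
   Context: $\mathbb{P}^3=(\mathbb{R}^4\setminus\{0\})/\!\sim$ is real projective space with the quotient topology. A point is finite if its fourth coordinate is nonzero; $\mathbf{n}_\infty=(0,0,0,1)^\top$. A camera is a rank-3 matrix $A=[\,G\ \ \mathbf{t}\,]\in\mathbb{R}^{3\times4}$, finite if $\det G\ne0$. The center of a finite camera is represented by $\mathbf{c}_A=(-G^{-1}\mathbf{t};\,1)\in\mathbb{R}^4$ and its principal ray is $\mathbf{n}_A=\det(G)A_{3,\bullet}^\top\in\mathbb{R}^4$ ($A_{3,\bullet}$ the third row). Write $\mathbf{c}_i=\mathbf{c}_{A_i}$, $\mathbf{n}_i=\mathbf{n}_{A_i}$. Cameras in an arrangement have pairwise distinct centers. For finite $\mathbf{q}$, $\operatorname{depth}(\mathbf{q};A)=\frac{1}{|\det G|\,\|G_{3,\bullet}\|}\cdot\frac{\mathbf{n}_A^\top\mathbf{q}}{\mathbf{n}_\infty^\top\mathbf{q}}$. The chiral domain $D_\mathcal{A}\subseteq\mathbb{P}^3$ is the closure of the set of finite points having positive depth in every camera of $\mathcal{A}$. Let $m,n\geq 1$ and let $\mathcal{P}=\{(\mathbf{p}_{1k},\ldots,\mathbf{p}_{mk})\in(\mathbb{R}^2)^m: k=1,\ldots,n\}$; write $\widehat{\mathbf{p}}=(\mathbf{p},1)\in\mathbb{R}^3$. A projective reconstruction of $\mathcal{P}$ is a pair $(\mathcal{A},\mathcal{Q})$ of an arrangement $\mathcal{A}=\{A_1,\ldots,A_m\}$ of finite cameras and points $\mathcal{Q}=\{\mathbf{q}_1,\ldots,\mathbf{q}_n\}\subseteq\mathbb{R}^4\setminus\{0\}$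 with $A_i\mathbf{q}_k=w_{ik}\widehat{\mathbf{p}}_{ik}$ for some nonzero scalars $w_{ik}$; consequently $\mathbf{n}_i^\top\mathbf{q}_k=\det(G_i)w_{ik}\ne0$. It is a chiral reconstruction if moreover $\mathbf{q}_k\in D_\mathcal{A}$ for all $k$. For $H\in\mathrm{GL}_4(\mathbb{R})$, $\mathcal{A}H^{-1}=\{A_1H^{-1},\ldots,A_mH^{-1}\}$ and $H\mathcal{Q}=\{H\mathbf{q}_1,\ldots,H\mathbf{q}_n\}$. *)

theory Defs
  imports "HOL-Analysis.Analysis"
begin

lemma vector_4 [simp]:
  "(vector [w, x, y, z] :: 'a::zero ^ 4) $ 1 = w"
  "(vector [w, x, y, z] :: 'a::zero ^ 4) $ 2 = x"
  "(vector [w, x, y, z] :: 'a::zero ^ 4) $ 3 = y"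
  "(vector [w, x, y, z] :: 'a::zero ^ 4) $ 4 = z"
  by (simp_all add: vector_def)

section \<open>Real projective space\<close>

definition proj_rel :: "((real ^ 4) \<times> (real ^ 4)) set" where
  "proj_rel = {(x, y). x \<noteq> 0 \<and> y \<noteq> 0 \<and> (\<exists>c. c \<noteq> 0 \<and> y = c *\<^sub>R x)}"

definition proj :: "real ^ 4 \<Rightarrow> (real ^ 4) set" where
  "proj x = proj_rel `` {x}"

definition proj_topology :: "(real ^ 4) set topology" where
  "proj_topology = topology (\<lambda>U. U \<subseteq> (- {0}) // proj_rel \<and> open {x. x \<noteq> 0 \<and> proj x \<in> U})"

lemma equiv_proj_rel: "equiv (- {0}) proj_rel"
proof (rule equivI)
  show "proj_rel \<subseteq> (- {0}) \<times> (- {0})" by (auto simp: proj_rel_def)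
  show "refl_on (- {0}) proj_rel" by (auto simp: refl_on_def proj_rel_def intro!: exI[of _ "1::real"])
  show "sym proj_rel"
  proof (rule symI)
    fix x y assume "(x, y) \<in> proj_rel"
    then obtain c where "x \<noteq> 0" "y \<noteq> 0" "c \<noteq> 0" "y = c *\<^sub>R x" by (auto simp: proj_rel_def)
    then have "x = inverse c *\<^sub>R y" "inverse c \<noteq> 0" by auto
    with \<open>x \<noteq> 0\<close> \<open>y \<noteq> 0\<close> show "(y, x) \<in> proj_rel" unfolding proj_rel_def by blast
  qed
  show "trans proj_rel"
  proof (rule transI)
    fix x y z assume "(x, y) \<in> proj_rel" "(y, z) \<in> proj_rel"
    then obtain c d where *: "x \<noteq> 0" "z \<noteq> 0" "c \<noteq> 0" "d \<noteq> 0" "y = c *\<^sub>R x" "z = d *\<^sub>R y"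
      by (auto simp: proj_rel_def)
    then have "z = (d * c) *\<^sub>R x" "d * c \<noteq> 0" by auto
    with * show "(x, z) \<in> proj_rel" unfolding proj_rel_def by blast
  qed
qed

lemma proj_eq_iff:
  assumes "x \<noteq> 0" "y \<noteq> 0"
  shows "proj x = proj y \<longleftrightarrow> (\<exists>c. c \<noteq> 0 \<and> y = c *\<^sub>R x)"
  using eq_equiv_class_iff[OF equiv_proj_rel, of x y] assms
  by (auto simp: proj_def proj_rel_def)

lemma openin_proj_topology:
  "openin proj_topology U \<longleftrightarrow>
     U \<subseteq> (- {0}) // proj_rel \<and> open {x. x \<noteq> 0 \<and> proj x \<in> U}"
proof -
  have "istopology (\<lambda>U. U \<subseteq> (- {0}) // proj_rel \<and> open {x. x \<noteq> 0 \<and> proj x \<in> U})"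
    unfolding istopology_def
  proof (intro conjI allI impI)
    fix S T :: "(real ^ 4) set set"
    assume S: "S \<subseteq> (- {0}) // proj_rel \<and> open {x. x \<noteq> 0 \<and> proj x \<in> S}"
      and T: "T \<subseteq> (- {0}) // proj_rel \<and> open {x. x \<noteq> 0 \<and> proj x \<in> T}"
    show "S \<inter> T \<subseteq> (- {0}) // proj_rel" using S by blast
    have "{x. x \<noteq> 0 \<and> proj x \<in> S \<inter> T} = {x. x \<noteq> 0 \<and> proj x \<in> S} \<inter> {x. x \<noteq> 0 \<and> proj x \<in> T}"
      by auto
    then show "open {x. x \<noteq> 0 \<and> proj x \<in> S \<inter> T}" using S T by auto
  next
    fix K :: "(real ^ 4) set set set"
    assume K: "\<forall>U\<in>K. U \<subseteq> (- {0}) // proj_rel \<and> open {x. x \<noteq> 0 \<and> proj x \<in> U}"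
    show "\<Union> K \<subseteq> (- {0}) // proj_rel" using K by blast
    have "{x. x \<noteq> 0 \<and> proj x \<in> \<Union> K} = (\<Union>U\<in>K. {x. x \<noteq> 0 \<and> proj x \<in> U})"
      by auto
    then show "open {x. x \<noteq> 0 \<and> proj x \<in> \<Union> K}" using K by auto
  qed
  then show ?thesis by (simp add: proj_topology_def)
qed

lemma topspace_proj_topology: "topspace proj_topology = (- {0}) // proj_rel"
proof
  show "topspace proj_topology \<subseteq> (- {0}) // proj_rel"
    using openin_proj_topology openin_topspace by blast
  have "{x. x \<noteq> 0 \<and> proj x \<in> (- {0}) // proj_rel} = - {0}"
    by (auto simp: proj_def intro: quotientI)
  then have "openin proj_topology ((- {0}) // proj_rel)"
    by (simp add: openin_proj_topology open_Compl)
  then show "(- {0}) // proj_rel \<subseteq> topspace proj_topology"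
    by (rule openin_subset)
qed

lemma quotient_map_proj: "quotient_map (top_of_set (- {0})) proj_topology proj"
proof -
  have "proj ` (- {0}) = (- {0}) // proj_rel"
    by (auto simp: proj_def quotient_def)
  moreover have "{x. x \<in> - {0} \<and> proj x \<in> U} = {x. x \<noteq> 0 \<and> proj x \<in> U}" for U
    by auto
  moreover have "openin (top_of_set (- {0})) V \<longleftrightarrow> open V" if "V \<subseteq> - {0 :: real ^ 4}" for V
    using that openin_open_eq[of "- {0 :: real ^ 4}" V] by (simp add: open_Compl)
  ultimately show ?thesis
    by (auto simp: quotient_map_def topspace_proj_topology openin_proj_topology)
qed

section \<open>Finite cameras\<close>

definition hom2 :: "real ^ 2 \<Rightarrow> real ^ 3" where
  "hom2 p = vector [p $ 1, p $ 2, 1]"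

definition n_inf :: "real ^ 4" where
  "n_inf = vector [0, 0, 0, 1]"

definition finite_point :: "real ^ 4 \<Rightarrow> bool" where
  "finite_point q \<longleftrightarrow> q $ 4 \<noteq> 0"

text \<open>A camera is \<open>A = [G t]\<close> with \<open>G = left_block A\<close> and \<open>t = column 4 A\<close>.\<close>

definition left_block :: "real ^ 4 ^ 3 \<Rightarrow> real ^ 3 ^ 3" where
  "left_block A = (\<chi> i. vector [A $ i $ 1, A $ i $ 2, A $ i $ 3])"

definition camera :: "real ^ 4 ^ 3 \<Rightarrow> bool" where
  "camera A \<longleftrightarrow> rank A = 3"

definition finite_camera :: "real ^ 4 ^ 3 \<Rightarrow> bool" where
  "finite_camera A \<longleftrightarrow> camera A \<and> det (left_block A) \<noteq> 0"

definition center :: "real ^ 4 ^ 3 \<Rightarrow> real ^ 4" where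
  "center A = (let c = - (matrix_inv (left_block A) *v column 4 A)
               in vector [c $ 1, c $ 2, c $ 3, 1])"

definition principal_ray :: "real ^ 4 ^ 3 \<Rightarrow> real ^ 4" where
  "principal_ray A = det (left_block A) *\<^sub>R row 3 A"

definition depth :: "real ^ 4 \<Rightarrow> real ^ 4 ^ 3 \<Rightarrow> real" where
  "depth q A = 1 / (\<bar>det (left_block A)\<bar> * norm (row 3 (left_block A)))
                 * ((principal_ray A \<bullet> q) / (n_inf \<bullet> q))"

lemma depth_scaleR: "c \<noteq> 0 \<Longrightarrow> depth (c *\<^sub>R q) A = depth q A"
  by (simp add: depth_def)

section \<open>Arrangements and reconstructions\<close>

text \<open>
  A family indexed by \<open>{1..m}\<close> (or \<open>{1..n}\<close>) is a function on \<open>nat\<close> whose values outside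
  the index range are irrelevant.
\<close>

definition finite_arrangement :: "nat \<Rightarrow> (nat \<Rightarrow> real ^ 4 ^ 3) \<Rightarrow> bool" where
  "finite_arrangement m A \<longleftrightarrow>
     (\<forall>i\<in>{1..m}. finite_camera (A i)) \<and> inj_on (\<lambda>i. proj (center (A i))) {1..m}"

definition chiral_domain :: "nat \<Rightarrow> (nat \<Rightarrow> real ^ 4 ^ 3) \<Rightarrow> (real ^ 4) set set" where
  "chiral_domain m A =
     proj_topology closure_of (proj ` {q. finite_point q \<and> (\<forall>i\<in>{1..m}. depth q (A i) > 0)})"

definition projective_reconstruction ::
  "nat \<Rightarrow> nat \<Rightarrow> (nat \<Rightarrow> nat \<Rightarrow> real ^ 2) \<Rightarrow> (nat \<Rightarrow> real ^ 4 ^ 3) \<Rightarrow> (nat \<Rightarrow> real ^ 4) \<Rightarrow> bool" where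
  "projective_reconstruction m n p A q \<longleftrightarrow>
     finite_arrangement m A \<and> (\<forall>k\<in>{1..n}. q k \<noteq> 0) \<and>
     (\<forall>i\<in>{1..m}. \<forall>k\<in>{1..n}. \<exists>w::real. w \<noteq> 0 \<and> A i *v q k = w *\<^sub>R hom2 (p i k))"

definition chiral_reconstruction ::
  "nat \<Rightarrow> nat \<Rightarrow> (nat \<Rightarrow> nat \<Rightarrow> real ^ 2) \<Rightarrow> (nat \<Rightarrow> real ^ 4 ^ 3) \<Rightarrow> (nat \<Rightarrow> real ^ 4) \<Rightarrow> bool" where
  "chiral_reconstruction m n p A q \<longleftrightarrow>
     projective_reconstruction m n p A q \<and> (\<forall>k\<in>{1..n}. proj (q k) \<in> chiral_domain m A)"

end

theory Submission
  imports Defs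
begin

text \<open>
  Write \<open>c i\<close> and \<open>n i\<close> for the center and the principal ray of the camera \<open>A i\<close>. The proof
  reduces chirality after a change of coordinates \<open>H\<close> to sign conditions on the original data;
  these conditions see \<open>H\<close> only through its last row \<open>h\<close> and the sign of \<open>det H\<close>.

  The first ingredient is a pointwise description of the chiral domain
  (\<open>proj_mem_chiral_domain_iff\<close>). The finite points with positive depth in all cameras lift to the
  set of \<open>y\<close> for which the fourth coordinate and all the numbers \<open>n i \<bullet> y\<close> are nonzero and have one
  common sign. A closure in projective space can be computed on lifts, so points of the chiral
  domain satisfy the corresponding weak inequalities. Conversely, let \<open>x\<close> satisfy them, with all
  \<open>n i \<bullet> x\<close> nonzero, as holds for every point of a reconstruction. Then the only weak inequality is
  the one for the fourth coordinate, and a small shift of \<open>x\<close> along \<open>n_inf\<close> makes it strict without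
  disturbing the others.

  The second ingredient is the transformation rule for cameras. Bordering a camera \<open>[G t]\<close> by a
  fourth row \<open>h\<close> gives a square matrix of determinant \<open>(h \<bullet> c) * det G\<close> (\<open>det_border\<close>). Comparing
  these determinants before and after multiplication by \<open>H\<close> shows that the new left block has
  determinant \<open>(h \<bullet> c) * det G / det H\<close>. Hence a finite camera stays finite exactly if
  \<open>h \<bullet> c \<noteq> 0\<close>, and the new principal ray pairs with \<open>H *v x\<close> to \<open>(h \<bullet> c) * (n \<bullet> x) / det H\<close>
  (\<open>principal_ray_transform\<close>), while the fourth coordinate of \<open>H *v x\<close> is \<open>h \<bullet> x\<close>.

  Substituting this into the description of the chiral domain
  (\<open>chiral_reconstruction_transform_iff\<close>) yields the inequalities of \<open>S1\<close> if \<open>det H > 0\<close> and those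
  of \<open>S2\<close> if \<open>det H < 0\<close>. A nonzero vector is the last row of matrices of either orientation
  (\<open>matrix_with_last_row_and_det\<close>), so an element of one of the two sets gives a suitable \<open>H\<close>.
\<close>

section \<open>Closures in projective space\<close>

text \<open>
  A set of nonzero vectors invariant under nonzero scaling is the full preimage of its image, and
  so is its closure away from the origin. As \<open>proj\<close> is a quotient map, the image of that closure is
  closed, which gives the forward direction; the converse is continuity of \<open>proj\<close>.
\<close>

lemma proj_mem_closure_of_iff:
  assumes "x \<noteq> 0" and "0 \<notin> S" and scale: "\<And>c y. c \<noteq> 0 \<Longrightarrow> y \<in> S \<Longrightarrow> c *\<^sub>R y \<in> S"
  shows "proj x \<in> proj_topology closure_of (proj ` S) \<longleftrightarrow> x \<in> closure S"
proof
  assume "x \<in> closure S"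
  moreover have "(- {0}) \<inter> S = S"
    using \<open>0 \<notin> S\<close> by auto
  ultimately have "x \<in> top_of_set (- {0}) closure_of S"
    using \<open>x \<noteq> 0\<close> by (simp add: closure_of_subtopology euclidean_closure_of)
  then show "proj x \<in> proj_topology closure_of (proj ` S)"
    using continuous_map_image_closure_subset[OF quotient_imp_continuous_map[OF quotient_map_proj]]
    by blast
next
  assume x: "proj x \<in> proj_topology closure_of (proj ` S)"
  define T where "T = closure S - {0}"
  have closure_scale: "c *\<^sub>R y \<in> closure S" if "c \<noteq> 0" "y \<in> closure S" for c y
  proof -
    have "(*\<^sub>R) c ` closure S = closure ((*\<^sub>R) c ` S)"
      by (simp add: closure_scaleR)
    also have "\<dots> \<subseteq> closure S"
      using scale \<open>c \<noteq> 0\<close> by (intro closure_mono) auto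
    finally show ?thesis using that by blast
  qed
  have preimage: "y \<in> T" if "y \<noteq> 0" "proj y \<in> proj ` T" for y
  proof -
    obtain z where z: "z \<in> T" "proj y = proj z"
      using \<open>proj y \<in> proj ` T\<close> by auto
    then obtain c where "c \<noteq> 0" "y = c *\<^sub>R z"
      using proj_eq_iff[of z y] \<open>y \<noteq> 0\<close> by (auto simp: T_def)
    then show ?thesis
      using z closure_scale by (auto simp: T_def)
  qed
  have "{y \<in> topspace (top_of_set (- {0})). proj y \<in> proj ` T} = (- {0}) \<inter> closure S"
    using preimage by (auto simp: T_def)
  then have "closedin (top_of_set (- {0})) {y \<in> topspace (top_of_set (- {0})). proj y \<in> proj ` T}"
    by (simp add: closedin_closed_Int)
  moreover have "proj ` T \<subseteq> topspace proj_topology"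
    by (auto simp: T_def topspace_proj_topology proj_def intro: quotientI)
  ultimately have "closedin proj_topology (proj ` T)"
    using quotient_map_proj unfolding quotient_map_closedin by blast
  moreover have "proj ` S \<subseteq> proj ` T"
    using \<open>0 \<notin> S\<close> closure_subset[of S] by (auto simp: T_def)
  ultimately have "proj_topology closure_of (proj ` S) \<subseteq> proj ` T"
    by (intro closure_of_minimal)
  then have "proj x \<in> proj ` T"
    using x by blast
  then have "x \<in> T"
    using \<open>x \<noteq> 0\<close> preimage by blast
  then show "x \<in> closure S"
    by (simp add: T_def)
qed

section \<open>The chiral domain\<close>

lemma inner_n_inf: "n_inf \<bullet> x = x $ 4"
  by (simp add: n_inf_def inner_vec_def sum_4)

lemma depth_pos_iff:
  assumes "det (left_block A) \<noteq> 0"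
  shows "depth y A > 0 \<longleftrightarrow> y $ 4 * (principal_ray A \<bullet> y) > 0"
proof -
  have "row 3 (left_block A) \<noteq> 0"
    using assms det_zero_row by blast
  then have "\<bar>det (left_block A)\<bar> * norm (row 3 (left_block A)) > 0"
    using assms by simp
  moreover define a where "a = \<bar>det (left_block A)\<bar> * norm (row 3 (left_block A))"
  ultimately have "a > 0"
    by blast
  then show ?thesis
    by (simp add: depth_def inner_n_inf flip: a_def)
      (auto simp: zero_less_divide_iff zero_less_mult_iff mult_less_0_iff)
qed

text \<open>
  The asymmetry between the weak sign condition on the fourth coordinate and the strict conditions
  on the principal rays reflects the assumption that \<open>x\<close> lies on no principal plane: the latter
  conditions are then stable under perturbation, and the former can be repaired by moving \<open>x\<close> in
  the direction of \<open>n_inf\<close>.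
\<close>

lemma proj_mem_chiral_domain_iff:
  assumes m: "m \<ge> 1"
    and det: "\<And>i. i \<in> {1..m} \<Longrightarrow> det (left_block (A i)) \<noteq> 0"
    and ray: "\<And>i. i \<in> {1..m} \<Longrightarrow> principal_ray (A i) \<bullet> x \<noteq> 0"
  shows "proj x \<in> chiral_domain m A \<longleftrightarrow>
    (\<forall>i\<in>{1..m}. x $ 4 * (principal_ray (A i) \<bullet> x) \<ge> 0) \<and>
    (\<forall>i\<in>{1..m}. \<forall>j\<in>{1..m}. (principal_ray (A i) \<bullet> x) * (principal_ray (A j) \<bullet> x) > 0)"
    (is "_ \<longleftrightarrow> ?far \<and> ?agree")
proof -
  define S where "S = {y. y $ 4 \<noteq> 0 \<and> (\<forall>i\<in>{1..m}. y $ 4 * (principal_ray (A i) \<bullet> y) > 0)}"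
  have S_eq: "{y. finite_point y \<and> (\<forall>i\<in>{1..m}. depth y (A i) > 0)} = S"
    using det by (auto simp: S_def finite_point_def depth_pos_iff)
  have "x \<noteq> 0"
    using ray[of 1] m by auto
  moreover have "c *\<^sub>R y \<in> S" if "c \<noteq> 0" "y \<in> S" for c y
  proof -
    have "(c *\<^sub>R y) $ 4 * (principal_ray (A i) \<bullet> (c *\<^sub>R y)) =
        c\<^sup>2 * (y $ 4 * (principal_ray (A i) \<bullet> y))" for i
      by (simp add: power2_eq_square)
    then have "(c *\<^sub>R y) $ 4 * (principal_ray (A i) \<bullet> (c *\<^sub>R y)) > 0" if "i \<in> {1..m}" for i
      using that \<open>c \<noteq> 0\<close> \<open>y \<in> S\<close> by (simp only: S_def mem_Collect_eq) simp
    then show ?thesis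
      using that by (simp add: S_def)
  qed
  ultimately have domain_iff: "proj x \<in> chiral_domain m A \<longleftrightarrow> x \<in> closure S"
    unfolding chiral_domain_def S_eq by (intro proj_mem_closure_of_iff) (auto simp: S_def)
  have "x \<in> closure S \<longleftrightarrow> ?far \<and> ?agree"
  proof
    assume x: "x \<in> closure S"
    have far: ?far
    proof
      fix i assume "i \<in> {1..m}"
      then have "S \<subseteq> {y. y $ 4 * (principal_ray (A i) \<bullet> y) \<ge> 0}"
        by (auto simp: S_def less_imp_le)
      moreover have "closed {y :: real ^ 4. y $ 4 * (principal_ray (A i) \<bullet> y) \<ge> 0}"
        by (intro closed_Collect_le continuous_intros)
      ultimately have "closure S \<subseteq> {y. y $ 4 * (principal_ray (A i) \<bullet> y) \<ge> 0}"
        by (rule closure_minimal)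
      with x show "x $ 4 * (principal_ray (A i) \<bullet> x) \<ge> 0"
        by blast
    qed
    have ?agree
    proof (intro ballI)
      fix i j assume ij: "i \<in> {1..m}" "j \<in> {1..m}"
      let ?C = "{y. (principal_ray (A i) \<bullet> y) * (principal_ray (A j) \<bullet> y) \<ge> 0}"
      have "S \<subseteq> ?C"
      proof
        fix y assume "y \<in> S"
        then have "y $ 4 * (principal_ray (A i) \<bullet> y) > 0" "y $ 4 * (principal_ray (A j) \<bullet> y) > 0"
          using ij by (simp_all add: S_def)
        then show "y \<in> ?C"
          by (auto simp: zero_less_mult_iff zero_le_mult_iff)
      qed
      moreover have "closed ?C"
        by (intro closed_Collect_le continuous_intros)
      ultimately have "closure S \<subseteq> ?C"
        by (rule closure_minimal)
      with x have "(principal_ray (A i) \<bullet> x) * (principal_ray (A j) \<bullet> x) \<ge> 0"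
        by blast
      with ray[OF ij(1)] ray[OF ij(2)]
      show "(principal_ray (A i) \<bullet> x) * (principal_ray (A j) \<bullet> x) > 0"
        by (simp add: order_less_le)
    qed
    with far show "?far \<and> ?agree" ..
  next
    assume fa: "?far \<and> ?agree"
    \<comment> \<open>Of the two lifts \<open>x\<close> and \<open>- x\<close>, the one with positive pairings is \<open>s *\<^sub>R x\<close>; moving it along
      \<open>+ n_inf\<close> means moving \<open>x\<close> along \<open>s *\<^sub>R n_inf\<close>.\<close>
    define s where "s = sgn (principal_ray (A 1) \<bullet> x)"
    define f where "f \<epsilon> = x + (\<epsilon> * s) *\<^sub>R n_inf" for \<epsilon> :: real
    have one: "1 \<in> {1..m}"
      using m by auto
    have s: "s = 1 \<or> s = -1"
      using ray[OF one] by (auto simp: s_def sgn_if)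
    have s_ray: "s * (principal_ray (A i) \<bullet> x) > 0" if "i \<in> {1..m}" for i
    proof -
      have "(principal_ray (A 1) \<bullet> x) * (principal_ray (A i) \<bullet> x) > 0"
        using fa one that by blast
      then show ?thesis
        unfolding s_def by (auto simp only: zero_less_mult_iff sgn_if split: if_splits)
    qed
    have s_last: "s * x $ 4 \<ge> 0"
    proof -
      have "x $ 4 * (principal_ray (A 1) \<bullet> x) \<ge> 0"
        using fa one by blast
      then show ?thesis
        using s s_ray[OF one] by (auto simp: zero_le_mult_iff zero_less_mult_iff)
    qed
    have lim: "(f \<longlongrightarrow> x) (at_right 0)"
    proof -
      have "((\<lambda>\<epsilon>. x + (\<epsilon> * s) *\<^sub>R n_inf) \<longlongrightarrow> x + (0 * s) *\<^sub>R n_inf) (at_right 0)"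
        by (intro tendsto_intros)
      then show ?thesis by (simp add: f_def[abs_def])
    qed
    have "\<forall>\<^sub>F \<epsilon> in at_right 0. s * (principal_ray (A i) \<bullet> f \<epsilon>) > 0" if "i \<in> {1..m}" for i
    proof -
      have "((\<lambda>\<epsilon>. s * (principal_ray (A i) \<bullet> f \<epsilon>)) \<longlongrightarrow> s * (principal_ray (A i) \<bullet> x)) (at_right 0)"
        by (intro tendsto_intros lim)
      then show ?thesis
        using s_ray[OF that] by (rule order_tendstoD)
    qed
    then have "\<forall>\<^sub>F \<epsilon> in at_right 0. \<forall>i\<in>{1..m}. s * (principal_ray (A i) \<bullet> f \<epsilon>) > 0"
      by (simp add: eventually_ball_finite_distrib)
    then have "\<forall>\<^sub>F \<epsilon> in at_right 0. f \<epsilon> \<in> S"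
      using eventually_at_right_less[of "0::real"]
    proof eventually_elim
      case (elim \<epsilon>)
      have "s * f \<epsilon> $ 4 = s * x $ 4 + \<epsilon>"
        using s by (auto simp: f_def n_inf_def)
      then have last: "s * f \<epsilon> $ 4 > 0"
        using s_last elim by simp
      have "f \<epsilon> $ 4 * (principal_ray (A i) \<bullet> f \<epsilon>) > 0" if "i \<in> {1..m}" for i
        using mult_pos_pos[OF last elim(1)[rule_format, OF that]] s by auto
      then show ?case
        using last by (auto simp: S_def)
    qed
    then have "\<forall>\<^sub>F \<epsilon> in at_right 0. f \<epsilon> \<in> closure S"
      by eventually_elim (use closure_subset in blast)
    with lim show "x \<in> closure S"
      by (intro Lim_in_closed_set[of "closure S" f "at_right 0"]) auto
  qed
  with domain_iff show ?thesis by simp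
qed

section \<open>Centers and bordered matrices\<close>

lemma matrix_vector_mult_left_block:
  "A *v v = left_block A *v vector [v $ 1, v $ 2, v $ 3] + v $ 4 *\<^sub>R column 4 A"
  by (simp add: vec_eq_iff matrix_vector_mult_def left_block_def sum_3 sum_4 column_def)

lemma matrix_inv_inverse:
  assumes "invertible M"
  shows "M ** matrix_inv M = mat 1" and "matrix_inv M ** M = mat 1"
  using someI_ex[OF assms[unfolded invertible_def]] unfolding matrix_inv_def by auto

lemma center_4: "center A $ 4 = 1"
  by (simp add: center_def Let_def)

lemma center_in_kernel:
  assumes "det (left_block A) \<noteq> 0"
  shows "A *v center A = 0"
proof -
  let ?G = "left_block A"
  define c where "c = - (matrix_inv ?G *v column 4 A)"
  have "invertible ?G"
    using assms by (simp add: invertible_det_nz)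
  then have "?G *v (matrix_inv ?G *v column 4 A) = column 4 A"
    by (simp add: matrix_vector_mul_assoc matrix_inv_inverse)
  moreover have "?G *v c = - (?G *v (matrix_inv ?G *v column 4 A))"
    using matrix_vector_mult_scaleR[of ?G "-1" "matrix_inv ?G *v column 4 A"]
    by (simp add: c_def)
  ultimately have "?G *v c = - column 4 A" by simp
  moreover have "vector [c $ 1, c $ 2, c $ 3] = c"
    by (simp add: vec_eq_iff forall_3 vector_3)
  ultimately show ?thesis
    unfolding matrix_vector_mult_left_block[of A]
    by (simp add: center_def Let_def c_def[symmetric])
qed

lemma kernel_eq_center:
  assumes "det (left_block A) \<noteq> 0" and "A *v v = 0"
  shows "v = v $ 4 *\<^sub>R center A"
proof -
  let ?G = "left_block A"
  define w where "w = v - v $ 4 *\<^sub>R center A"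
  have w4: "w $ 4 = 0"
    by (simp add: w_def center_4)
  have "A *v w = 0"
    using assms center_in_kernel[OF assms(1)]
    by (simp add: w_def matrix_vector_mult_diff_distrib matrix_vector_mult_scaleR)
  then have "?G *v vector [w $ 1, w $ 2, w $ 3] = 0"
    using w4 by (simp add: matrix_vector_mult_left_block[of A])
  moreover have "invertible ?G"
    using assms by (simp add: invertible_det_nz)
  then have "matrix_inv ?G *v (?G *v u) = u" for u
    by (simp add: matrix_vector_mul_assoc matrix_inv_inverse)
  ultimately have "vector [w $ 1, w $ 2, w $ 3] = (0 :: real ^ 3)"
    by (metis matrix_vector_mult_0_right)
  then have "w = 0"
    using w4 by (simp add: vec_eq_iff forall_3 forall_4 vector_3)
  then show ?thesis
    by (simp add: w_def)
qed

text \<open>Cofactor expansion along the last row, the row that a bordered camera matrix adds.\<close>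

lemma det_4:
  fixes M :: "'a::comm_ring_1 ^ 4 ^ 4"
  shows "det M =
      M$4$4 * (M$1$1 * (M$2$2 * M$3$3 - M$2$3 * M$3$2) - M$1$2 * (M$2$1 * M$3$3 - M$2$3 * M$3$1)
               + M$1$3 * (M$2$1 * M$3$2 - M$2$2 * M$3$1))
    - M$4$3 * (M$1$1 * (M$2$2 * M$3$4 - M$2$4 * M$3$2) - M$1$2 * (M$2$1 * M$3$4 - M$2$4 * M$3$1)
               + M$1$4 * (M$2$1 * M$3$2 - M$2$2 * M$3$1))
    + M$4$2 * (M$1$1 * (M$2$3 * M$3$4 - M$2$4 * M$3$3) - M$1$3 * (M$2$1 * M$3$4 - M$2$4 * M$3$1)
               + M$1$4 * (M$2$1 * M$3$3 - M$2$3 * M$3$1))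
    - M$4$1 * (M$1$2 * (M$2$3 * M$3$4 - M$2$4 * M$3$3) - M$1$3 * (M$2$2 * M$3$4 - M$2$4 * M$3$2)
               + M$1$4 * (M$2$2 * M$3$3 - M$2$3 * M$3$2))"
proof -
  have f: "finite {2::4, 3, 4}" "1 \<notin> {2::4, 3, 4}" "finite {3::4, 4}" "2 \<notin> {3::4, 4}"
    "finite {4::4}" "3 \<notin> {4::4}"
    by auto
  show ?thesis
    unfolding det_def UNIV_4
    unfolding sum_over_permutations_insert[OF f(1,2)] sum_over_permutations_insert[OF f(3,4)]
      sum_over_permutations_insert[OF f(5,6)]
    unfolding permutes_sing
    by (simp add: sign_swap_id sign_compose permutation_compose permutation_swap_id sign_id)
      (simp add: Transposition.transpose_def algebra_simps)
qed

text \<open>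
  The functional \<open>h \<mapsto> det (border A h)\<close> is the pairing of \<open>h\<close> with the vector of signed maximal
  minors of \<open>A\<close>, which spans the kernel of \<open>A\<close>. This ties \<open>det (left_block A)\<close>, its value at
  \<open>n_inf\<close>, to the center in a way that is compatible with changes of coordinates.
\<close>

definition border :: "real ^ 4 ^ 3 \<Rightarrow> real ^ 4 \<Rightarrow> real ^ 4 ^ 4" where
  "border A h = vector [A $ 1, A $ 2, A $ 3, h]"

lemma det_border_n_inf: "det (border A n_inf) = det (left_block A)"
  by (simp add: det_4 det_3 border_def n_inf_def left_block_def algebra_simps)

text \<open>
  Multiplying on the right by the unipotent matrix whose last column is the center replaces the
  last column of the bordered matrix by \<open>(0, 0, 0, h \<bullet> c)\<close>, since the center spans the kernel of
  the camera; the determinant is then block triangular.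
\<close>

lemma det_border:
  assumes "det (left_block A) \<noteq> 0"
  shows "det (border A h) = (h \<bullet> center A) * det (left_block A)"
proof -
  define C :: "real ^ 4 ^ 4" where
    "C = (\<chi> i j. if j = 4 then center A $ i else if i = j then 1 else 0)"
  define M where "M = border A h ** C"
  have M: "M $ i $ j = (if j = 4 then (border A h *v center A) $ i else border A h $ i $ j)" for i j
    using exhaust_4[of j]
    by (auto simp: M_def C_def matrix_matrix_mult_def matrix_vector_mult_def sum_4)
  have "(A *v center A) $ i = 0" for i
    by (simp add: center_in_kernel[OF assms])
  then have "(border A h *v center A) $ 1 = 0" "(border A h *v center A) $ 2 = 0"
      "(border A h *v center A) $ 3 = 0" "(border A h *v center A) $ 4 = h \<bullet> center A"
    by (simp_all add: border_def matrix_vector_mult_def inner_vec_def)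
  then have "det M = (h \<bullet> center A) * det (left_block A)"
    by (simp add: det_4 det_3 M) (simp add: border_def left_block_def algebra_simps)
  moreover have "det C = 1"
    by (simp add: det_4 C_def center_4)
  ultimately show ?thesis
    by (simp add: M_def det_mul)
qed

lemma border_mult: "border A h ** B = border (A ** B) (h v* B)"
proof -
  have "(border A h ** B) $ i = border (A ** B) (h v* B) $ i" for i
    using exhaust_4[of i]
    by (auto simp: border_def matrix_matrix_mult_def vector_matrix_mult_def vec_eq_iff mult.commute)
  then show ?thesis
    by (simp add: vec_eq_iff)
qed

section \<open>Change of projective coordinates\<close>

context
  fixes A :: "real ^ 4 ^ 3" and H :: "real ^ 4 ^ 4"
  assumes det_A: "det (left_block A) \<noteq> 0" and H: "invertible H"
begin

text \<open>
  \<open>H\<close> carries the border \<open>n_inf\<close> of the new camera to the border \<open>row 4 H\<close> of the old one, so the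
  claim is the multiplicativity of the determinant of bordered matrices.
\<close>

lemma det_left_block_transform:
  "det (left_block (A ** matrix_inv H)) * det H = (row 4 H \<bullet> center A) * det (left_block A)"
proof -
  have "n_inf v* H = row 4 H"
    by (simp add: vec_eq_iff vector_matrix_mult_def sum_4 n_inf_def row_def)
  moreover have "(A ** matrix_inv H) ** H = A"
    using H by (simp add: matrix_mul_assoc[symmetric] matrix_inv_inverse)
  ultimately have "border (A ** matrix_inv H) n_inf ** H = border A (row 4 H)"
    by (simp add: border_mult)
  then have "det (border (A ** matrix_inv H) n_inf) * det H = det (border A (row 4 H))"
    by (metis det_mul)
  then show ?thesis
    by (simp add: det_border_n_inf det_border[OF det_A])
qed

lemma det_left_block_transform_nonzero_iff:
  "det (left_block (A ** matrix_inv H)) \<noteq> 0 \<longleftrightarrow> row 4 H \<bullet> center A \<noteq> 0"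
  using det_left_block_transform det_A H by (auto simp: invertible_det_nz)

lemma transform_apply: "(A ** matrix_inv H) *v (H *v x) = A *v x"
  using H by (simp add: matrix_vector_mul_assoc matrix_mul_assoc[symmetric] matrix_inv_inverse)

text \<open>
  \<open>H\<close> maps the kernel of the old camera to that of the new one; the scalar is forced by the
  normalization of the fourth coordinate of a center to 1.
\<close>

lemma center_transform:
  assumes "row 4 H \<bullet> center A \<noteq> 0"
  shows "H *v center A = (row 4 H \<bullet> center A) *\<^sub>R center (A ** matrix_inv H)"
proof -
  have "(A ** matrix_inv H) *v (H *v center A) = 0"
    by (simp only: transform_apply center_in_kernel[OF det_A])
  moreover have "(H *v center A) $ 4 = row 4 H \<bullet> center A"
    by (simp add: matrix_vector_mult_def inner_vec_def row_def)
  ultimately show ?thesis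
    using kernel_eq_center assms det_left_block_transform_nonzero_iff by metis
qed

lemma principal_ray_transform:
  "(principal_ray (A ** matrix_inv H) \<bullet> (H *v x)) * det H =
     (row 4 H \<bullet> center A) * (principal_ray A \<bullet> x)"
proof -
  have row: "row 3 B \<bullet> y = (B *v y) $ 3" for B :: "real ^ 4 ^ 3" and y
    by (simp add: matrix_vector_mult_def inner_vec_def row_def)
  have "(principal_ray (A ** matrix_inv H) \<bullet> (H *v x)) * det H =
      (det (left_block (A ** matrix_inv H)) * det H) * (A *v x) $ 3"
    by (simp add: principal_ray_def row transform_apply)
  then show ?thesis
    by (simp add: det_left_block_transform principal_ray_def row)
qed

end

lemma finite_camera_transform_iff:
  assumes A: "finite_camera A" and H: "invertible H"
  shows "finite_camera (A ** matrix_inv H) \<longleftrightarrow> row 4 H \<bullet> center A \<noteq> 0"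
proof -
  have "rank ((A ** matrix_inv H) ** H) \<le> rank (A ** matrix_inv H)"
    by (rule rank_mul_le_left)
  moreover have "(A ** matrix_inv H) ** H = A"
    using H by (simp add: matrix_mul_assoc[symmetric] matrix_inv_inverse)
  moreover have "rank (A ** matrix_inv H) \<le> 3"
    using rank_bound[of "A ** matrix_inv H"] by simp
  ultimately have "rank (A ** matrix_inv H) = 3"
    using A by (simp add: finite_camera_def camera_def)
  then show ?thesis
    using A det_left_block_transform_nonzero_iff[OF _ H]
    by (simp add: finite_camera_def camera_def)
qed

text \<open>
  The image points are unchanged, and the new centers are images of the old ones under a
  projective bijection, so finiteness of the cameras is the only condition that can fail.
\<close>

lemma projective_reconstruction_transform_iff:
  assumes rec: "projective_reconstruction m n p A q" and H: "invertible H"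
  shows "projective_reconstruction m n p (\<lambda>i. A i ** matrix_inv H) (\<lambda>k. H *v q k) \<longleftrightarrow>
    (\<forall>i\<in>{1..m}. row 4 H \<bullet> center (A i) \<noteq> 0)"
proof
  assume "projective_reconstruction m n p (\<lambda>i. A i ** matrix_inv H) (\<lambda>k. H *v q k)"
  then show "\<forall>i\<in>{1..m}. row 4 H \<bullet> center (A i) \<noteq> 0"
    using rec finite_camera_transform_iff[OF _ H]
    by (simp add: projective_reconstruction_def finite_arrangement_def)
next
  assume c: "\<forall>i\<in>{1..m}. row 4 H \<bullet> center (A i) \<noteq> 0"
  have fin: "finite_camera (A i)" "det (left_block (A i)) \<noteq> 0" if "i \<in> {1..m}" for i
    using rec that by (auto simp: projective_reconstruction_def finite_arrangement_def finite_camera_def)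
  have H_cancel: "matrix_inv H *v (H *v v) = v" for v
    using H by (simp add: matrix_vector_mul_assoc matrix_inv_inverse)
  have nonzero: "center B \<noteq> 0" for B
    by (metis center_4 zero_index zero_neq_one)
  have "inj_on (\<lambda>i. proj (center (A i ** matrix_inv H))) {1..m}"
  proof (rule inj_onI)
    fix i j assume ij: "i \<in> {1..m}" "j \<in> {1..m}"
      and "proj (center (A i ** matrix_inv H)) = proj (center (A j ** matrix_inv H))"
    then obtain a where a: "a \<noteq> 0"
        "center (A j ** matrix_inv H) = a *\<^sub>R center (A i ** matrix_inv H)"
      using nonzero by (auto simp: proj_eq_iff)
    define b where "b = (row 4 H \<bullet> center (A j)) * a / (row 4 H \<bullet> center (A i))"
    have b: "b \<noteq> 0"
      using a c ij by (auto simp: b_def)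
    have "H *v center (A j) = b *\<^sub>R (H *v center (A i))"
      using a c ij by (simp add: center_transform[OF fin(2) H] b_def)
    also have "\<dots> = H *v (b *\<^sub>R center (A i))"
      by (simp add: matrix_vector_mult_scaleR)
    finally have "center (A j) = b *\<^sub>R center (A i)"
      by (metis H_cancel)
    then have "proj (center (A i)) = proj (center (A j))"
      using b nonzero by (auto simp: proj_eq_iff)
    moreover have "inj_on (\<lambda>i. proj (center (A i))) {1..m}"
      using rec unfolding projective_reconstruction_def finite_arrangement_def by blast
    ultimately show "i = j"
      using ij by (auto dest: inj_onD)
  qed
  then have "finite_arrangement m (\<lambda>i. A i ** matrix_inv H)"
    using c fin(1) finite_camera_transform_iff[OF _ H] unfolding finite_arrangement_def by blast
  moreover have "H *v q k \<noteq> 0" if "k \<in> {1..n}" for k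
  proof
    assume "H *v q k = 0"
    then have "q k = 0"
      using H_cancel[of "q k"] by simp
    with rec that show False
      unfolding projective_reconstruction_def by blast
  qed
  moreover have "\<exists>w. w \<noteq> 0 \<and> (A i ** matrix_inv H) *v (H *v q k) = w *\<^sub>R hom2 (p i k)"
    if "i \<in> {1..m}" "k \<in> {1..n}" for i k
    using rec that unfolding projective_reconstruction_def transform_apply[OF fin(2)[OF that(1)] H]
    by blast
  ultimately show "projective_reconstruction m n p (\<lambda>i. A i ** matrix_inv H) (\<lambda>k. H *v q k)"
    unfolding projective_reconstruction_def by blast
qed

text \<open>An image point \<open>hom2 p\<close> is finite, so a reconstructed point lies on no principal plane.\<close>

lemma principal_ray_inner_nonzero:
  assumes "projective_reconstruction m n p A q" "i \<in> {1..m}" "k \<in> {1..n}"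
  shows "principal_ray (A i) \<bullet> q k \<noteq> 0"
proof -
  obtain w where "w \<noteq> 0" "A i *v q k = w *\<^sub>R hom2 (p i k)"
    using assms unfolding projective_reconstruction_def by blast
  then have "(A i *v q k) $ 3 \<noteq> 0"
    by (simp add: hom2_def vector_3)
  moreover have "row 3 (A i) \<bullet> q k = (A i *v q k) $ 3"
    by (simp add: matrix_vector_mult_def inner_vec_def row_def)
  ultimately show ?thesis
    using assms by (auto simp: principal_ray_def projective_reconstruction_def
        finite_arrangement_def finite_camera_def)
qed

text \<open>
  The factor \<open>1 / det H\<close> enters each transformed principal ray once. It survives, up to its sign,
  in the product with the fourth coordinate and squares away in a product of two rays; this is why
  exactly the first family of inequalities differs between \<open>S1\<close> and \<open>S2\<close>.
\<close>

lemma chiral_reconstruction_transform_iff: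
  assumes m: "m \<ge> 1" and rec: "projective_reconstruction m n p A q" and H: "invertible H"
  defines "h \<equiv> row 4 H"
  shows "chiral_reconstruction m n p (\<lambda>i. A i ** matrix_inv H) (\<lambda>k. H *v q k) \<longleftrightarrow>
    (\<forall>i\<in>{1..m}. h \<bullet> center (A i) \<noteq> 0) \<and>
    (\<forall>k\<in>{1..n}.
      (\<forall>i\<in>{1..m}.
        ((h \<bullet> q k) * (h \<bullet> center (A i)) * (principal_ray (A i) \<bullet> q k)) / det H \<ge> 0) \<and>
      (\<forall>i\<in>{1..m}. \<forall>j\<in>{1..m}.
        (h \<bullet> center (A i)) * (h \<bullet> center (A j)) *
        (principal_ray (A i) \<bullet> q k) * (principal_ray (A j) \<bullet> q k) > 0))"
proof (cases "\<forall>i\<in>{1..m}. h \<bullet> center (A i) \<noteq> 0")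
  case False
  then show ?thesis
    using projective_reconstruction_transform_iff[OF rec H]
    by (auto simp: chiral_reconstruction_def h_def)
next
  case True
  let ?A = "\<lambda>i. A i ** matrix_inv H"
  have fin: "det (left_block (A i)) \<noteq> 0" if "i \<in> {1..m}" for i
    using rec that by (auto simp: projective_reconstruction_def finite_arrangement_def finite_camera_def)
  have rec': "projective_reconstruction m n p ?A (\<lambda>k. H *v q k)"
    using projective_reconstruction_transform_iff[OF rec H] True by (simp add: h_def)
  have detH: "det H \<noteq> 0"
    using H by (simp add: invertible_det_nz)
  have last: "(H *v x) $ 4 = h \<bullet> x" for x
    by (simp add: h_def matrix_vector_mult_def inner_vec_def row_def)
  have ray: "principal_ray (?A i) \<bullet> (H *v x) =
      (h \<bullet> center (A i)) * (principal_ray (A i) \<bullet> x) / det H" if "i \<in> {1..m}" for i x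
    using principal_ray_transform[OF fin[OF that] H, of x] detH by (simp add: h_def field_simps)
  have "proj (H *v q k) \<in> chiral_domain m ?A \<longleftrightarrow>
      (\<forall>i\<in>{1..m}. ((h \<bullet> q k) * (h \<bullet> center (A i)) * (principal_ray (A i) \<bullet> q k)) / det H \<ge> 0) \<and>
      (\<forall>i\<in>{1..m}. \<forall>j\<in>{1..m}. (h \<bullet> center (A i)) * (h \<bullet> center (A j)) *
        (principal_ray (A i) \<bullet> q k) * (principal_ray (A j) \<bullet> q k) > 0)"
    if k: "k \<in> {1..n}" for k
  proof -
    have "proj (H *v q k) \<in> chiral_domain m ?A \<longleftrightarrow>
      (\<forall>i\<in>{1..m}. (H *v q k) $ 4 * (principal_ray (?A i) \<bullet> (H *v q k)) \<ge> 0) \<and>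
      (\<forall>i\<in>{1..m}. \<forall>j\<in>{1..m}.
        (principal_ray (?A i) \<bullet> (H *v q k)) * (principal_ray (?A j) \<bullet> (H *v q k)) > 0)"
    proof (rule proj_mem_chiral_domain_iff[OF m])
      show "det (left_block (?A i)) \<noteq> 0" if "i \<in> {1..m}" for i
        using rec' that
        by (auto simp: projective_reconstruction_def finite_arrangement_def finite_camera_def)
      show "principal_ray (?A i) \<bullet> (H *v q k) \<noteq> 0" if "i \<in> {1..m}" for i
        using principal_ray_inner_nonzero[OF rec' that k] .
    qed
    moreover have "(H *v q k) $ 4 * (principal_ray (?A i) \<bullet> (H *v q k)) =
        ((h \<bullet> q k) * (h \<bullet> center (A i)) * (principal_ray (A i) \<bullet> q k)) / det H"
      if "i \<in> {1..m}" for i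
      by (simp add: ray[OF that] last)
    moreover have "(principal_ray (?A i) \<bullet> (H *v q k)) * (principal_ray (?A j) \<bullet> (H *v q k)) > 0 \<longleftrightarrow>
        (h \<bullet> center (A i)) * (h \<bullet> center (A j)) *
        (principal_ray (A i) \<bullet> q k) * (principal_ray (A j) \<bullet> q k) > 0"
      if "i \<in> {1..m}" "j \<in> {1..m}" for i j
    proof -
      have "(principal_ray (?A i) \<bullet> (H *v q k)) * (principal_ray (?A j) \<bullet> (H *v q k)) =
        ((h \<bullet> center (A i)) * (h \<bullet> center (A j)) *
        (principal_ray (A i) \<bullet> q k) * (principal_ray (A j) \<bullet> q k)) / (det H)\<^sup>2"
        by (simp add: ray[OF that(1)] ray[OF that(2)] power2_eq_square)
      then show ?thesis
        using detH by (simp add: zero_less_divide_iff)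
    qed
    ultimately show ?thesis by simp
  qed
  then show ?thesis
    using rec' True by (simp add: chiral_reconstruction_def)
qed

text \<open>
  A rotation can have the unit vector along \<open>h\<close> as its last row; scaling the last row restores the
  length of \<open>h\<close>, and scaling the first row adjusts the determinant, including its sign.
\<close>

lemma matrix_with_last_row_and_det:
  fixes h :: "real ^ 4"
  assumes "h \<noteq> 0" and "d \<noteq> 0"
  obtains H where "row 4 H = h" and "det H = d" and "invertible H"
proof -
  have unit: "norm (h /\<^sub>R norm h) = 1"
    using \<open>h \<noteq> 0\<close> by simp
  have "2 \<le> CARD(4)" by simp
  from rotation_matrix_exists_basis[where k = 4, OF this unit]
  obtain R where R: "rotation_matrix R" "R *v axis 4 1 = h /\<^sub>R norm h"
    by blast
  define D :: "real ^ 4 ^ 4" where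
    "D = (\<chi> i j. if i = j then vector [d / norm h, 1, 1, norm h] $ i else 0)"
  define H where "H = D ** transpose R"
  have "det D = d"
    using \<open>h \<noteq> 0\<close> by (simp add: det_4 D_def)
  moreover have "det H = det D * det R"
    by (simp only: H_def det_mul det_transpose)
  ultimately have det: "det H = d"
    using R(1) by (simp add: rotation_matrix_def)
  have "R $ j $ 4 = h $ j / norm h" for j
  proof -
    have "(R *v axis 4 1) $ j = h $ j / norm h"
      by (simp add: R(2) divide_inverse)
    then show ?thesis
      by (simp add: matrix_vector_mult_basis column_def)
  qed
  then have "row 4 H = h"
    using \<open>h \<noteq> 0\<close>
    by (simp add: vec_eq_iff row_def H_def D_def matrix_matrix_mult_def sum_4 transpose_def)
  with det \<open>d \<noteq> 0\<close> that show thesis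
    by (simp add: invertible_det_nz)
qed

section \<open>Characterization of projective reconstructions that can be made chiral\<close>

theorem theorem6:
  fixes m n :: nat
    and p :: "nat \<Rightarrow> nat \<Rightarrow> real ^ 2"
    and A :: "nat \<Rightarrow> real ^ 4 ^ 3"
    and q :: "nat \<Rightarrow> real ^ 4"
    and \<sigma> :: "nat \<Rightarrow> nat \<Rightarrow> real"
    and S1 S2 :: "(real ^ 4) set"
  assumes "m \<ge> 1" and "n \<ge> 1"
    and "projective_reconstruction m n p A q"
    and "\<forall>i\<in>{1..m}. \<forall>k\<in>{1..n}. \<sigma> i k = sgn (principal_ray (A i) \<bullet> q k)"
    and "S1 = {h. \<forall>i\<in>{1..m}. \<forall>j\<in>{1..m}. \<forall>k\<in>{1..n}.
                (h \<bullet> q k) * (h \<bullet> center (A i)) * \<sigma> i k \<ge> 0 \<and>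
                (h \<bullet> center (A i)) * (h \<bullet> center (A j)) * \<sigma> i k * \<sigma> j k > 0}"
    and "S2 = {h. \<forall>i\<in>{1..m}. \<forall>j\<in>{1..m}. \<forall>k\<in>{1..n}.
                (h \<bullet> q k) * (h \<bullet> center (A i)) * \<sigma> i k \<le> 0 \<and>
                (h \<bullet> center (A i)) * (h \<bullet> center (A j)) * \<sigma> i k * \<sigma> j k > 0}"
  shows "(\<exists>(H :: real ^ 4 ^ 4) h. invertible H \<and> row 4 H = h \<and>
            chiral_reconstruction m n p (\<lambda>i. A i ** matrix_inv H) (\<lambda>k. H *v q k))
         \<longleftrightarrow> S1 \<noteq> {} \<or> S2 \<noteq> {}"
proof -
  have zero_le_sgn: "x * sgn y \<ge> 0 \<longleftrightarrow> x * y \<ge> 0" for x y :: real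
    by (cases "y > 0"; cases "y = 0") (auto simp: sgn_if zero_le_mult_iff mult_le_0_iff)
  have sgn_le_zero: "x * sgn y \<le> 0 \<longleftrightarrow> x * y \<le> 0" for x y :: real
    by (cases "y > 0"; cases "y = 0") (auto simp: sgn_if zero_le_mult_iff mult_le_0_iff)
  have zero_less_sgn: "x * sgn y * sgn z > 0 \<longleftrightarrow> x * y * z > 0" for x y z :: real
    by (auto simp: sgn_if zero_less_mult_iff mult_less_0_iff)
  have one: "1 \<in> {1..m}" "1 \<in> {1..n}"
    using assms(1,2) by auto
  define agree where "agree h \<longleftrightarrow> (\<forall>i\<in>{1..m}. \<forall>j\<in>{1..m}. \<forall>k\<in>{1..n}.
      (h \<bullet> center (A i)) * (h \<bullet> center (A j)) *
      (principal_ray (A i) \<bullet> q k) * (principal_ray (A j) \<bullet> q k) > 0)" for h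
  have S1: "h \<in> S1 \<longleftrightarrow> agree h \<and> (\<forall>i\<in>{1..m}. \<forall>k\<in>{1..n}.
      (h \<bullet> q k) * (h \<bullet> center (A i)) * (principal_ray (A i) \<bullet> q k) \<ge> 0)" for h
    using assms(4) one unfolding assms(5) agree_def
    by (simp add: zero_le_sgn zero_less_sgn) blast
  have S2: "h \<in> S2 \<longleftrightarrow> agree h \<and> (\<forall>i\<in>{1..m}. \<forall>k\<in>{1..n}.
      (h \<bullet> q k) * (h \<bullet> center (A i)) * (principal_ray (A i) \<bullet> q k) \<le> 0)" for h
    using assms(4) one unfolding assms(6) agree_def
    by (simp add: sgn_le_zero zero_less_sgn) blast
  have center: "h \<bullet> center (A i) \<noteq> 0" if "agree h" "i \<in> {1..m}" for h i
    using that one unfolding agree_def by fastforce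
  have chiral: "chiral_reconstruction m n p (\<lambda>i. A i ** matrix_inv H) (\<lambda>k. H *v q k) \<longleftrightarrow>
      (if det H > 0 then row 4 H \<in> S1 else row 4 H \<in> S2)" if "invertible H" for H
  proof -
    have "det H \<noteq> 0"
      using that by (simp add: invertible_det_nz)
    then have "chiral_reconstruction m n p (\<lambda>i. A i ** matrix_inv H) (\<lambda>k. H *v q k) \<longleftrightarrow>
        agree (row 4 H) \<and> (\<forall>i\<in>{1..m}. \<forall>k\<in>{1..n}.
          ((row 4 H \<bullet> q k) * (row 4 H \<bullet> center (A i)) * (principal_ray (A i) \<bullet> q k)) / det H \<ge> 0)"
      unfolding chiral_reconstruction_transform_iff[OF assms(1,3) that]
      using center unfolding agree_def by blast
    moreover have "x / det H \<ge> 0 \<longleftrightarrow> (if det H > 0 then x \<ge> 0 else x \<le> 0)" for x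
      using \<open>det H \<noteq> 0\<close> by (auto simp: zero_le_divide_iff)
    ultimately show ?thesis
      by (simp add: S1 S2)
  qed
  have nonzero: "h \<noteq> 0" if "h \<in> S1 \<or> h \<in> S2" for h
    using that center[OF _ one(1), of h] S1 S2 by auto
  show ?thesis
  proof
    assume "\<exists>(H :: real ^ 4 ^ 4) h. invertible H \<and> row 4 H = h \<and>
      chiral_reconstruction m n p (\<lambda>i. A i ** matrix_inv H) (\<lambda>k. H *v q k)"
    then show "S1 \<noteq> {} \<or> S2 \<noteq> {}"
      using chiral by (metis empty_iff)
  next
    assume "S1 \<noteq> {} \<or> S2 \<noteq> {}"
    then obtain h d where h: "h \<noteq> 0" "(d::real) \<noteq> 0" "if d > 0 then h \<in> S1 else h \<in> S2"
    proof
      assume "S1 \<noteq> {}"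
      with nonzero that[of _ 1] show ?thesis by auto
    next
      assume "S2 \<noteq> {}"
      with nonzero that[of _ "-1"] show ?thesis by auto
    qed
    obtain H where "row 4 H = h" "det H = d" "invertible H"
      using matrix_with_last_row_and_det h(1,2) by blast
    with h(3) chiral show "\<exists>(H :: real ^ 4 ^ 4) h. invertible H \<and> row 4 H = h \<and>
      chiral_reconstruction m n p (\<lambda>i. A i ** matrix_inv H) (\<lambda>k. H *v q k)"
      by auto
  qed
qed

end
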